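(* Let $X$ be a Banach space, $Y$ a normed vector space, $k\in Y\setminus\{0\}$, let $K:X\rightrightarrows Y$ be a variable domination structure, $\Omega\subseteq X$ a closed set, and $f:X\rightarrow Y$ a mapping. Let $\varepsilon,\delta>0$ and let $\tilde{x}\in\Omega$ be an $(\varepsilon,\delta,k)$-nondominated solution with respect to $K$ for $f$ on $\Omega$. Assume: (a) (Continuity condition) $f$ is continuous over $\overline{B}(\tilde{x},\varepsilon)\cap\Omega$, and $K$ has locally closed graph; (b) (Scalarization condition) $K(x)+(0,+\infty)k\subseteq K(x)\setminus\{0\}$ for all $x\in\overline{B}(\tilde{x},\varepsilon)\cap\Omega$. Then for every $\varepsilon'\in(0,\varepsilon)$ there exists an element $\overline{x}\in\Omega$ such that: (i) $s^{f}_{k,f(\tilde{x})-K}(\overline{x})+\sqrt{\delta}\,\|\overline{x}-\tilde{x}\|\leq s^{f}_{k,f(\tilde{x})-K}(\tilde{x})$; (ii) $\|\overline{x}-\tilde{x}\|\leq\min\{\sqrt{\delta},\varepsilon'\}$; (iii) $\overline{x}$ is a strict minimal point on $\overline{B}(\tilde{x},\varepsilon')\cap\Omega$ of the scalar function $x\mapsto s^{f}_{k,f(\tilde{x})-K}(x)+\sqrt{\delta}\,\|\overline{x}-x\|$.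
   Context: Normed spaces are real; $B(x,r)$ and $\overline{B}(x,r)$ denote the open and closed balls with center $x$ and radius $r$. A variable domination structure $K:X\rightrightarrows Y$ is a set-valued mapping whose values $K(x)$, $x\in X$, are closed, convex, proper and pointed cones (pointed: $K(x)\cap(-K(x))=\{0\}$). Its graph is $\operatorname{Gr}K=\{(x,y)\mid y\in K(x)\}$; locally closed graph means that $\operatorname{Gr}K$ is closed around each of its points. A point $\tilde{x}\in\Omega$ is an $(\varepsilon,\delta,k)$-nondominated solution with respect to $K$ for $f$ on $\Omega$ if for every $x\in B(\tilde{x},\varepsilon)\cap\Omega$, $$\{f(x)-f(\tilde{x})+\delta k\}\cap(-K(x))\subseteq\{0\}.$$ For $a\in Y$, the scalarizing function $s^{f}_{k,a-K}:X\to\mathbb{R}\cup\{\pm\infty\}$ is defined by $$s^{f}_{k,a-K}(x):=\inf\{t\in\mathbb{R}\mid f(x)\in a+tk-K(x)\},\qquad \inf\emptyset:=+\infty.$$ A point $\overline{x}\in A$ is a strict minimal point of $g$ on $A$ if $g(x)>g(\overline{x})$ for all $x\in A\setminus\{\overline{x}\}$. *)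

theory Defs
  imports "HOL-Analysis.Analysis"
begin

definition pointed :: "'b::real_vector set \<Rightarrow> bool"
  where "pointed C \<longleftrightarrow> C \<inter> uminus ` C = {0}"

(* A cone is proper if it is neither {0} nor the whole space; convex_cone includes
   nonemptiness, so every such cone contains 0. *)
definition domination_structure :: "('a \<Rightarrow> 'b::real_normed_vector set) \<Rightarrow> bool"
  where "domination_structure K \<longleftrightarrow>
    (\<forall>x. closed (K x) \<and> convex_cone (K x) \<and> K x \<noteq> {0} \<and> K x \<noteq> UNIV \<and> pointed (K x))"

definition Gr :: "('a \<Rightarrow> 'b set) \<Rightarrow> ('a \<times> 'b) set"
  where "Gr K = {(x, y). y \<in> K x}"

definition closed_around :: "'c::metric_space set \<Rightarrow> 'c \<Rightarrow> bool"
  where "closed_around S p \<longleftrightarrow> (\<exists>r>0. closed (S \<inter> cball p r))"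

definition locally_closed_graph ::
    "('a::real_normed_vector \<Rightarrow> 'b::real_normed_vector set) \<Rightarrow> bool"
  where "locally_closed_graph K \<longleftrightarrow> (\<forall>p\<in>Gr K. closed_around (Gr K) p)"

definition nondominated_solution ::
    "real \<Rightarrow> real \<Rightarrow> 'b \<Rightarrow> ('a::real_normed_vector \<Rightarrow> 'b::real_normed_vector set) \<Rightarrow>
     ('a \<Rightarrow> 'b) \<Rightarrow> 'a set \<Rightarrow> 'a \<Rightarrow> bool"
  where "nondominated_solution \<epsilon> \<delta> k K f \<Omega> xt \<longleftrightarrow> xt \<in> \<Omega> \<and>
    (\<forall>x \<in> ball xt \<epsilon> \<inter> \<Omega>. {f x - f xt + \<delta> *\<^sub>R k} \<inter> uminus ` K x \<subseteq> {0})"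

(* In ereal, Inf {} is plus infinity. *)
definition scalarization ::
    "'b \<Rightarrow> 'b \<Rightarrow> ('a \<Rightarrow> 'b::real_vector set) \<Rightarrow> ('a \<Rightarrow> 'b) \<Rightarrow> 'a \<Rightarrow> ereal"
  where "scalarization k a K f x =
    Inf {ereal t | t. f x \<in> (\<lambda>y. a + t *\<^sub>R k - y) ` K x}"

definition strict_minimal_point :: "('a \<Rightarrow> 'c::linorder) \<Rightarrow> 'a set \<Rightarrow> 'a \<Rightarrow> bool"
  where "strict_minimal_point g A xb \<longleftrightarrow> xb \<in> A \<and> (\<forall>x \<in> A - {xb}. g x > g xb)"

end

theory Submission
  imports Defs
begin

text \<open>
  Because the values of \<open>K\<close> are cones, local closedness of the graph at the points \<open>(x, 0)\<close>
  forces the whole graph to be closed. On the relevant set, the sublevel set of the scalarization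
  at height \<open>c\<close> is the preimage of the graph under \<open>x \<mapsto> (x, a + c k - f x)\<close>, so the
  scalarization is lower semicontinuous. It is at most \<open>0\<close> at the nondominated solution and is bounded
  below by \<open>-\<delta>\<close>, so Ekeland's variational principle with parameter \<open>sqrt \<delta>\<close> applies.
\<close>

text \<open>Ekeland's variational principle for a finite function, with lower semicontinuity on
  \<open>D\<close> expressed by closed sublevel sets. A sequence that descends in the order given by
  \<open>T\<close>, each term nearly minimizing \<open>h\<close> below its predecessor, converges to
  a minimal element of that order.\<close>

lemma ekeland_real:
  fixes h :: "'a::metric_space \<Rightarrow> real"
  assumes D: "complete D" and lsc: "\<And>c. closed {x \<in> D. h x \<le> c}"
    and lower: "\<And>x. x \<in> D \<Longrightarrow> m \<le> h x" and x0: "x0 \<in> D" and l: "l > 0"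
  obtains xb where "xb \<in> D" "h xb + l * dist x0 xb \<le> h x0"
    "\<And>x. x \<in> D \<Longrightarrow> x \<noteq> xb \<Longrightarrow> h xb < h x + l * dist xb x"
proof -
  \<comment> \<open>\<open>T x\<close> collects the points below \<open>x\<close> in Ekeland's
    order: moving there lowers \<open>h\<close> by at least \<open>l\<close> times the distance. The
    last two claims say that \<open>xb\<close> lies in \<open>T x0\<close> and that
    \<open>T xb\<close> has no element other than \<open>xb\<close>.\<close>
  define T where "T x = {y \<in> D. h y + l * dist x y \<le> h x}" for x
  have T_self: "x \<in> T x" if "x \<in> D" for x
    using that by (simp add: T_def)
  have T_le: "h y \<le> h x" if "y \<in> T x" for x y
    using that mult_nonneg_nonneg[OF less_imp_le[OF l] zero_le_dist[of x y]]
    by (auto simp: T_def)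
  have T_trans: "z \<in> T x" if "y \<in> T x" "z \<in> T y" for x y z
  proof -
    have "l * dist x z \<le> l * dist x y + l * dist y z"
      using mult_left_mono[OF dist_triangle[of x z y]] l by (simp add: algebra_simps)
    then show ?thesis using that by (auto simp: T_def)
  qed
  have bdd: "bdd_below (h ` T x)" for x
    using lower by (auto simp: T_def intro!: bdd_belowI2[of _ m])
  have "\<exists>y. y \<in> T x \<and> (\<forall>z \<in> T x. h y \<le> h z + (1/2)^n)" if x: "x \<in> D" for x and n :: nat
  proof -
    have "Inf (h ` T x) < Inf (h ` T x) + (1/2)^n" by simp
    then obtain y where "y \<in> T x" "h y < Inf (h ` T x) + (1/2)^n"
      using cInf_lessD[of "h ` T x"] T_self[OF x] by blast
    moreover have "Inf (h ` T x) \<le> h z" if "z \<in> T x" for z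
      using that bdd by (intro cInf_lower) auto
    ultimately show ?thesis by (intro exI[of _ y]) force
  qed
  \<comment> \<open>The vacuous premise \<open>Suc n = 0\<close> only fits the shape of
    \<open>dependent_nat_choice\<close>, whose invariant may depend on the index; at index 0 the
    same conjunct pins the start to \<open>x0\<close>.\<close>
  then have step: "\<exists>y. (y \<in> D \<and> (Suc n = 0 \<longrightarrow> y = x0)) \<and>
      (y \<in> T x \<and> (\<forall>z \<in> T x. h y \<le> h z + (1/2)^n))"
    if "x \<in> D" for x and n :: nat
    using that unfolding T_def by fastforce
  have "\<exists>X. \<forall>n. (X n \<in> D \<and> (n = 0 \<longrightarrow> X n = x0)) \<and>
      (X (Suc n) \<in> T (X n) \<and> (\<forall>z \<in> T (X n). h (X (Suc n)) \<le> h z + (1/2)^n))"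
    by (rule dependent_nat_choice) (use x0 step in blast)+
  then obtain X where X0: "X 0 = x0" and XD: "\<And>n. X n \<in> D"
    and Xstep: "\<And>n. X (Suc n) \<in> T (X n) \<and> (\<forall>z \<in> T (X n). h (X (Suc n)) \<le> h z + (1/2)^n)"
    by blast
  have XT: "X j \<in> T (X i)" if "i \<le> j" for i j
    using that
  proof (induction rule: dec_induct)
    case base
    then show ?case using T_self XD by blast
  next
    case (step n)
    then show ?case using T_trans Xstep by blast
  qed
  have "decseq (\<lambda>n. h (X n))"
  proof (rule decseq_SucI)
    show "h (X (Suc n)) \<le> h (X n)" for n
      using Xstep T_le by blast
  qed
  then obtain L where "(\<lambda>n. h (X n)) \<longlonglongrightarrow> L"
    using decseq_convergent[of "\<lambda>n. h (X n)" m] lower XD by blast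
  then have hC: "Cauchy (\<lambda>n. h (X n))" by (rule LIMSEQ_imp_Cauchy)
  \<comment> \<open>The absolute value covers both orders of the indices, so the Cauchy property
    passes from the values of \<open>h\<close> to the points.\<close>
  have dist_le: "l * dist (X i) (X j) \<le> \<bar>h (X i) - h (X j)\<bar>" for i j
    using XT[of i j] XT[of j i] by (cases "i \<le> j") (auto simp: T_def dist_commute)
  have "Cauchy X"
  proof (rule metric_CauchyI)
    fix e :: real assume "e > 0"
    then obtain N where N: "\<And>i j. i \<ge> N \<Longrightarrow> j \<ge> N \<Longrightarrow> dist (h (X i)) (h (X j)) < l * e"
      using metric_CauchyD[OF hC, of "l * e"] l by auto
    show "\<exists>M. \<forall>i\<ge>M. \<forall>j\<ge>M. dist (X i) (X j) < e"
    proof (intro exI allI impI)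
      fix i j assume "i \<ge> N" "j \<ge> N"
      then have "l * dist (X i) (X j) < l * e"
        using dist_le[of i j] N[of i j] by (simp add: dist_real_def)
      then show "dist (X i) (X j) < e" using l by simp
    qed
  qed
  then obtain xb where xb: "xb \<in> D" and lim: "X \<longlonglongrightarrow> xb"
    using D XD unfolding complete_def by blast
  have xbT: "xb \<in> T (X n)" for n
  proof -
    \<comment> \<open>The distances to \<open>X j\<close> only converge to the distance to
      \<open>xb\<close>, hence the slack \<open>e\<close>: with it, almost all \<open>X j\<close>
      lie in one fixed sublevel set, and its closedness puts \<open>xb\<close> there too.\<close>
    have "h xb \<le> h (X n) - l * dist (X n) xb + e" if "e > 0" for e
    proof -
      have "(\<lambda>j. l * dist (X n) (X j)) \<longlonglongrightarrow> l * dist (X n) xb"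
        by (intro tendsto_intros lim)
      then have "\<forall>\<^sub>F j in sequentially. l * dist (X n) xb - e < l * dist (X n) (X j)"
        using that by (intro order_tendstoD) auto
      then have "\<forall>\<^sub>F j in sequentially.
          X j \<in> {x \<in> D. h x \<le> h (X n) - l * dist (X n) xb + e}"
        using eventually_ge_at_top[of n]
      proof eventually_elim
        case (elim j)
        then show ?case using XT[of n j] by (auto simp: T_def)
      qed
      then show ?thesis
        using Lim_in_closed_set[OF lsc _ _ lim] by auto
    qed
    then have "h xb \<le> h (X n) - l * dist (X n) xb" by (rule field_le_epsilon)
    then show ?thesis using xb by (simp add: T_def)
  qed
  show thesis
  proof
    show "xb \<in> D" by fact
    show "h xb + l * dist x0 xb \<le> h x0"
      using xbT[of 0] X0 by (simp add: T_def)
    show "h xb < h x + l * dist xb x" if "x \<in> D" "x \<noteq> xb" for x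
    proof (rule ccontr)
      assume "\<not> ?thesis"
      then have x: "x \<in> T xb" using that by (simp add: T_def)
      \<comment> \<open>By transitivity \<open>x\<close> lies in every \<open>T (X n)\<close>, so
        near-minimality gives \<open>h (X (Suc n)) \<le> h x + (1/2)^n\<close>. Since
        \<open>h xb\<close> is no larger than \<open>h (X (Suc n))\<close>, the drop from
        \<open>h xb\<close> to \<open>h x\<close>, and with it the distance term, is squeezed to
        0.\<close>
      have "l * dist xb x \<le> (1/2)^n" for n :: nat
      proof -
        have "h (X (Suc n)) \<le> h x + (1/2)^n"
          using Xstep T_trans[OF xbT x] by blast
        moreover have "h xb \<le> h (X (Suc n))" by (rule T_le[OF xbT])
        ultimately show ?thesis using x by (simp add: T_def)
      qed
      moreover have "(\<lambda>n. (1/2::real)^n) \<longlonglongrightarrow> 0"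
        by (rule LIMSEQ_realpow_zero) auto
      ultimately have "l * dist xb x \<le> 0"
        using LIMSEQ_le_const by blast
      then show False using l that by (simp add: mult_le_0_iff)
    qed
  qed
qed

text \<open>On the sublevel set \<open>D\<close> of \<open>x0\<close> the function is finite and the
  real version applies. Outside \<open>D\<close> the strict inequality is automatic, because there
  \<open>g x\<close> exceeds \<open>g x0\<close>, which bounds \<open>g xb\<close> from
  above.\<close>

lemma ekeland_ereal:
  fixes g :: "'a::metric_space \<Rightarrow> ereal"
  assumes S: "complete S" and lsc: "\<And>c. closed {x \<in> S. g x \<le> ereal c}"
    and lower: "\<And>x. x \<in> S \<Longrightarrow> ereal m \<le> g x"
    and x0: "x0 \<in> S" "g x0 < \<infinity>" and l: "l > 0"
  obtains xb where "xb \<in> S" "g xb + ereal (l * dist x0 xb) \<le> g x0"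
    "\<And>x. x \<in> S \<Longrightarrow> x \<noteq> xb \<Longrightarrow> g xb < g x + ereal (l * dist xb x)"
proof -
  obtain r where r: "g x0 = ereal r"
    using x0 lower[of x0] by (cases "g x0") auto
  define D where "D = {x \<in> S. g x \<le> ereal r}"
  have fin: "g x = ereal (real_of_ereal (g x))" if "x \<in> D" for x
    using that lower[of x] by (cases "g x") (auto simp: D_def)
  have "real_of_ereal (g x) \<le> c \<longleftrightarrow> g x \<le> ereal c" if "x \<in> D" for x c
    using fin[OF that] by (metis ereal_less_eq(3))
  then have "{x \<in> D. real_of_ereal (g x) \<le> c} = D \<inter> {x \<in> S. g x \<le> ereal c}" for c
    by (auto simp: D_def)
  then have lsc': "closed {x \<in> D. real_of_ereal (g x) \<le> c}" for c
    using lsc by (simp add: D_def closed_Int)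
  have "D = S \<inter> D" by (auto simp: D_def)
  then have "complete D"
    using complete_Int_closed[OF S lsc[of r]] by (simp add: D_def)
  moreover have "m \<le> real_of_ereal (g x)" if "x \<in> D" for x
    using that lower[of x] fin[of x] by (metis D_def ereal_less_eq(3) mem_Collect_eq)
  moreover have "x0 \<in> D" using x0 r by (simp add: D_def)
  ultimately obtain xb where xb: "xb \<in> D"
    "real_of_ereal (g xb) + l * dist x0 xb \<le> real_of_ereal (g x0)"
    "\<And>x. x \<in> D \<Longrightarrow> x \<noteq> xb \<Longrightarrow> real_of_ereal (g xb) < real_of_ereal (g x) + l * dist xb x"
    using ekeland_real[of D "\<lambda>x. real_of_ereal (g x)" m x0 l] lsc' l by blast
  show thesis
  proof
    show "xb \<in> S" using xb by (simp add: D_def)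
    show "g xb + ereal (l * dist x0 xb) \<le> g x0"
      using xb(2) fin[OF xb(1)] r by (metis ereal_less_eq(3) plus_ereal.simps(1) real_of_ereal.simps(1))
    show "g xb < g x + ereal (l * dist xb x)" if "x \<in> S" "x \<noteq> xb" for x
    proof (cases "x \<in> D")
      case True
      then show ?thesis
        using xb(3)[OF True] that fin[OF True] fin[OF xb(1)]
        by (metis less_ereal.simps(1) plus_ereal.simps(1))
    next
      case False
      have "g xb \<le> ereal r" using xb(1) by (simp add: D_def)
      also have "\<dots> < g x" using False that by (simp add: D_def)
      also have "\<dots> \<le> g x + ereal (l * dist xb x)"
        using l by (intro ereal_le_add_self) simp
      finally show ?thesis .
    qed
  qed
qed

text \<open>The limit of a sequence in the graph is not yet known to lie in the graph, so local
  closedness cannot be used at the limit itself. The point \<open>(x, 0)\<close> does lie in the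
  graph, and shrinking the second components by a factor \<open>t\<close> moves the tail of the
  sequence near it without leaving the cones.\<close>

lemma closed_Gr:
  assumes cone: "\<And>x. convex_cone (K x)" and "locally_closed_graph K"
  shows "closed (Gr K)"
  unfolding closed_sequential_limits
proof (intro allI impI, elim conjE)
  fix q p assume q: "\<forall>n. q n \<in> Gr K" and lim: "q \<longlonglongrightarrow> p"
  obtain x y where p: "p = (x, y)" by force
  have scale: "t *\<^sub>R v \<in> K u" if "v \<in> K u" "t \<ge> 0" for t u v
    using cone[of u] that by (auto simp: convex_cone_def conic_def)
  have "0 \<in> K x" using cone[of x] by (simp add: convex_cone_contains_0)
  then obtain r where r: "r > 0" "closed (Gr K \<inter> cball (x, 0) r)"
    using assms(2) by (force simp: locally_closed_graph_def closed_around_def Gr_def)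
  \<comment> \<open>The summand 1 keeps the denominator positive when \<open>y\<close> is 0 and
    makes \<open>t * norm y < r\<close> strict, so that the scaled limit is interior to the
    ball.\<close>
  define t where "t = r / (1 + norm y)"
  have t: "t > 0" "t * norm y < r"
    using r by (auto simp: t_def field_simps add_pos_nonneg)
  have lim': "(\<lambda>n. (fst (q n), t *\<^sub>R snd (q n))) \<longlonglongrightarrow> (x, t *\<^sub>R y)"
    using lim p by (auto intro!: tendsto_eq_intros)
  have "(x, t *\<^sub>R y) \<in> ball (x, 0) r"
    using t by (simp add: dist_Pair_Pair)
  then have "\<forall>\<^sub>F n in sequentially. (fst (q n), t *\<^sub>R snd (q n)) \<in> ball (x, 0) r"
    using topological_tendstoD[OF lim' open_ball] by blast
  then have "\<forall>\<^sub>F n in sequentially. (fst (q n), t *\<^sub>R snd (q n)) \<in> Gr K \<inter> cball (x, 0) r"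
  proof eventually_elim
    case (elim n)
    have "snd (q n) \<in> K (fst (q n))" using q[rule_format, of n] by (simp add: Gr_def case_prod_unfold)
    then have "t *\<^sub>R snd (q n) \<in> K (fst (q n))" using scale t by auto
    with elim show ?case by (auto simp: Gr_def)
  qed
  then have "(x, t *\<^sub>R y) \<in> Gr K"
    using Lim_in_closed_set[OF r(2) _ _ lim'] by auto
  then have "(1 / t) *\<^sub>R t *\<^sub>R y \<in> K x"
    using t by (intro scale[of "t *\<^sub>R y"]) (auto simp: Gr_def)
  then show "p \<in> Gr K" using t p by (simp add: Gr_def)
qed

lemma scalarization_eq:
  "scalarization k a K f x = Inf (ereal ` {t. a + t *\<^sub>R k - f x \<in> K x})"
proof -
  have "(f x \<in> (\<lambda>y. a + t *\<^sub>R k - y) ` K x) \<longleftrightarrow> a + t *\<^sub>R k - f x \<in> K x" for t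
  proof
    assume "a + t *\<^sub>R k - f x \<in> K x"
    then show "f x \<in> (\<lambda>y. a + t *\<^sub>R k - y) ` K x"
      by (rule rev_image_eqI) simp
  qed force
  then show ?thesis
    unfolding scalarization_def by (auto intro!: arg_cong[of _ _ Inf])
qed

text \<open>The admissible \<open>t\<close> form an upward closed set by \<open>up\<close>, and a
  closed one because \<open>K x\<close> is closed. Hence every real bound on the infimum is itself
  admissible.\<close>

lemma scalarization_le_iff:
  fixes k :: "'b::real_normed_vector"
  assumes "closed (K x)" and up: "\<And>y t. y \<in> K x \<Longrightarrow> t > 0 \<Longrightarrow> y + t *\<^sub>R k \<in> K x"
  shows "scalarization k a K f x \<le> ereal c \<longleftrightarrow> a + c *\<^sub>R k - f x \<in> K x"
proof
  assume "a + c *\<^sub>R k - f x \<in> K x"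
  then show "scalarization k a K f x \<le> ereal c"
    unfolding scalarization_eq by (intro Inf_lower) auto
next
  assume le: "scalarization k a K f x \<le> ereal c"
  have ev: "a + t *\<^sub>R k - f x \<in> K x" if "t > c" for t
  proof -
    have "scalarization k a K f x < ereal t"
      using le that by (meson le_less_trans less_ereal.simps(1))
    then obtain s where s: "s < t" "a + s *\<^sub>R k - f x \<in> K x"
      unfolding scalarization_eq Inf_less_iff by auto
    then show ?thesis
      using up[OF s(2), of "t - s"] by (simp add: algebra_simps)
  qed
  have "((\<lambda>t. a + t *\<^sub>R k - f x) \<longlongrightarrow> a + c *\<^sub>R k - f x) (at_right c)"
    by (intro tendsto_intros)
  moreover have "\<forall>\<^sub>F t in at_right c. a + t *\<^sub>R k - f x \<in> K x"
    using ev by (auto simp: eventually_at_filter)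
  ultimately show "a + c *\<^sub>R k - f x \<in> K x"
    using Lim_in_closed_set[OF assms(1)] by fastforce
qed

theorem theorem3p1:
  fixes k :: "'b::real_normed_vector"
    and K :: "'a::banach \<Rightarrow> 'b set"
    and \<Omega> :: "'a set"
    and f :: "'a \<Rightarrow> 'b"
    and \<epsilon> \<delta> :: real
    and xt :: 'a
  assumes "k \<noteq> 0"
    and "domination_structure K"
    and "closed \<Omega>"
    and "\<epsilon> > 0" and "\<delta> > 0"
    and "nondominated_solution \<epsilon> \<delta> k K f \<Omega> xt"
    and "continuous_on (cball xt \<epsilon> \<inter> \<Omega>) f"
    and "locally_closed_graph K"
    and "\<forall>x \<in> cball xt \<epsilon> \<inter> \<Omega>. {y + t *\<^sub>R k | y t. y \<in> K x \<and> t > 0} \<subseteq> K x - {0}"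
  shows "\<forall>\<epsilon>' \<in> {0<..<\<epsilon>}. \<exists>xb \<in> \<Omega>.
    scalarization k (f xt) K f xb + ereal (sqrt \<delta> * norm (xb - xt))
      \<le> scalarization k (f xt) K f xt \<and>
    norm (xb - xt) \<le> min (sqrt \<delta>) \<epsilon>' \<and>
    strict_minimal_point
      (\<lambda>x. scalarization k (f xt) K f x + ereal (sqrt \<delta> * norm (xb - x)))
      (cball xt \<epsilon>' \<inter> \<Omega>) xb"
proof
  fix \<epsilon>' assume "\<epsilon>' \<in> {0<..<\<epsilon>}"
  then have \<epsilon>': "0 < \<epsilon>'" "\<epsilon>' < \<epsilon>" by auto
  \<comment> \<open>A closed ball gives completeness, and the smaller radius keeps it inside the
    open ball on which nondominatedness is assumed.\<close>
  define S where "S = cball xt \<epsilon>' \<inter> \<Omega>"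
  define s where "s = scalarization k (f xt) K f"
  have S_sub: "S \<subseteq> cball xt \<epsilon> \<inter> \<Omega>" using \<epsilon>' by (auto simp: S_def)
  have xt: "xt \<in> S"
    using assms(6) \<epsilon>' by (auto simp: S_def nondominated_solution_def)
  have K: "closed (K x)" "convex_cone (K x)" for x
    using assms(2) by (auto simp: domination_structure_def)
  have up: "y + t *\<^sub>R k \<in> K x - {0}" if "x \<in> S" "y \<in> K x" "t > 0" for x y t
    using assms(9) that S_sub by blast
  have s_le: "s x \<le> ereal c \<longleftrightarrow> f xt + c *\<^sub>R k - f x \<in> K x" if "x \<in> S" for x c
    unfolding s_def using K up[OF that] by (intro scalarization_le_iff) auto
  have "closed S" using assms(3) by (auto simp: S_def)
  have lsc: "closed {x \<in> S. s x \<le> ereal c}" for c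
  proof -
    have "continuous_on S (\<lambda>x. (x, f xt + c *\<^sub>R k - f x))"
      using continuous_on_subset[OF assms(7) S_sub] by (intro continuous_intros)
    then have "closed (S \<inter> (\<lambda>x. (x, f xt + c *\<^sub>R k - f x)) -` Gr K)"
      using \<open>closed S\<close> closed_Gr[OF K(2) assms(8)] by (rule continuous_closed_preimage)
    moreover have "{x \<in> S. s x \<le> ereal c} = S \<inter> (\<lambda>x. (x, f xt + c *\<^sub>R k - f x)) -` Gr K"
      using s_le by (auto simp: Gr_def)
    ultimately show ?thesis by simp
  qed
  \<comment> \<open>A value below \<open>- \<delta>\<close> would give some
    \<open>t < - \<delta>\<close> with \<open>f xt + t *\<^sub>R k - f x\<close> in
    \<open>K x\<close>. Adding the positive multiple \<open>- \<delta> - t\<close> of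
    \<open>k\<close> raises the level to exactly \<open>- \<delta>\<close>, and the scalarization
    condition makes the result nonzero. Its negative then violates nondominatedness, which tolerates
    only 0.\<close>
  have lower: "ereal (- \<delta>) \<le> s x" if x: "x \<in> S" for x
  proof (rule ccontr)
    assume "\<not> ?thesis"
    then obtain t where t: "s x < ereal t" "t < - \<delta>"
      using ereal_dense2[of "s x" "ereal (- \<delta>)"] by (auto simp: not_le)
    then have "f xt + t *\<^sub>R k - f x \<in> K x" using s_le[OF x] less_imp_le by blast
    from up[OF x this, of "- \<delta> - t"] t
    have "f xt - \<delta> *\<^sub>R k - f x \<in> K x - {0}" by (simp add: algebra_simps)
    moreover have "f x - f xt + \<delta> *\<^sub>R k = - (f xt - \<delta> *\<^sub>R k - f x)" by simp
    ultimately have "f x - f xt + \<delta> *\<^sub>R k \<in> uminus ` K x" "f x - f xt + \<delta> *\<^sub>R k \<noteq> 0"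
      by (metis DiffD1 imageI, metis DiffD2 insertI1 neg_equal_0_iff_equal)
    moreover have "x \<in> ball xt \<epsilon> \<inter> \<Omega>" using x \<epsilon>' by (auto simp: S_def)
    ultimately show False using assms(6) by (force simp: nondominated_solution_def)
  qed
  have "s xt \<le> 0"
    using s_le[OF xt, of 0] K(2) by (simp add: convex_cone_contains_0 zero_ereal_def)
  then have fin: "s xt < \<infinity>" by auto
  have "complete S" using \<open>closed S\<close> by (simp add: complete_eq_closed)
  moreover have "sqrt \<delta> > 0" using \<open>\<delta> > 0\<close> by simp
  ultimately obtain xb where xb: "xb \<in> S" "s xb + ereal (sqrt \<delta> * dist xt xb) \<le> s xt"
    "\<And>x. x \<in> S \<Longrightarrow> x \<noteq> xb \<Longrightarrow> s xb < s x + ereal (sqrt \<delta> * dist xb x)"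
    using ekeland_ereal[OF _ lsc lower xt fin] by blast
  \<comment> \<open>The total descent available is at most \<open>\<delta>\<close>, which equals
    \<open>sqrt \<delta> * sqrt \<delta>\<close>; cancelling the Ekeland parameter leaves the radius
    \<open>sqrt \<delta>\<close>.\<close>
  have "ereal (- \<delta>) + ereal (sqrt \<delta> * dist xt xb) \<le> s xb + ereal (sqrt \<delta> * dist xt xb)"
    using lower[OF xb(1)] by (rule add_right_mono)
  also have "\<dots> \<le> 0" using xb(2) \<open>s xt \<le> 0\<close> by (rule order_trans)
  finally have "sqrt \<delta> * dist xt xb \<le> sqrt \<delta> * sqrt \<delta>"
    using \<open>\<delta> > 0\<close> by (simp add: zero_ereal_def)
  then have "dist xt xb \<le> sqrt \<delta>"
    by (rule mult_left_le_imp_le) (use \<open>\<delta> > 0\<close> in simp)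
  then have "norm (xb - xt) \<le> min (sqrt \<delta>) \<epsilon>'"
    using xb(1) by (simp add: S_def dist_norm norm_minus_commute)
  moreover have "strict_minimal_point (\<lambda>x. s x + ereal (sqrt \<delta> * norm (xb - x))) S xb"
    using xb by (simp add: strict_minimal_point_def dist_norm zero_ereal_def[symmetric])
  ultimately show "\<exists>xb \<in> \<Omega>.
    scalarization k (f xt) K f xb + ereal (sqrt \<delta> * norm (xb - xt))
      \<le> scalarization k (f xt) K f xt \<and>
    norm (xb - xt) \<le> min (sqrt \<delta>) \<epsilon>' \<and>
    strict_minimal_point
      (\<lambda>x. scalarization k (f xt) K f x + ereal (sqrt \<delta> * norm (xb - x)))
      (cball xt \<epsilon>' \<inter> \<Omega>) xb"
    using xb by (intro bexI[of _ xb]) (auto simp: s_def S_def dist_norm norm_minus_commute)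
qed

end
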